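(* Let $\lambda_1,\lambda_2,u,v\in\mathbb{Z}$ with $\gcd(u,v)=1$ and $v\mid(\lambda_1-\lambda_2)$, let $\Lambda=\operatorname{diag}(\lambda_1,\lambda_2)$, $M=\begin{pmatrix}1&u\\0&v\end{pmatrix}$, and assume $A=M\Lambda M^{-1}\in\operatorname{M}_2(\mathbb{Z})$ is non-singular with $\mathcal{P}'\ne\emptyset$. Assume $\operatorname{rad}(\lambda_1)$ does not divide $\operatorname{rad}(\lambda_2)$ and $\operatorname{rad}(\lambda_2)$ does not divide $\operatorname{rad}(\lambda_1)$. Then $T\in\operatorname{End}(G_A)$ if and only if $T=MXM^{-1}$ with $X=\operatorname{diag}(x_1,x_2)$, where $x_i\in\mathbb{Z}[\lambda_i^{-1}]$ for $i=1,2$ and $\frac{x_1-x_2}{v}\in\mathcal{R}$. In particular, $\operatorname{End}(G_A)$ is commutative, isomorphic to a subring of $\mathbb{Z}[\lambda_1^{-1}]\times\mathbb{Z}[\lambda_2^{-1}]$, and lies inside the centralizer of $A$ in $\operatorname{M}_2(\mathcal{R})$.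
   Context: $G_A=\{A^k\mathbf{x}\mid\mathbf{x}\in\mathbb{Z}^2,k\in\mathbb{Z}\}\subseteq\mathbb{Q}^2$; every group endomorphism of $G_A$ is given by a matrix in $\operatorname{M}_2(\mathbb{Q})$, and $\operatorname{End}(G_A)$ is identified with the set of $T\in\operatorname{M}_2(\mathbb{Q})$ with $T(G_A)\subseteq G_A$. $\mathcal{R}=\mathbb{Z}[1/\det A]$. $\mathcal{P}$ is the set of primes dividing $\det A$, $\mathcal{P}'=\{p\in\mathcal{P}\mid h_A\not\equiv x^2\pmod p\}$ with $h_A$ the characteristic polynomial of $A$. For a nonzero integer $m\ne\pm1$, $\operatorname{rad}(m)$ is the product of the distinct primes dividing $m$. $\mathbb{Z}[\lambda^{-1}]\subseteq\mathbb{Q}$ is the ring generated by $1/\lambda$. *)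

theory Defs
  imports
    "HOL-Algebra.Generated_Rings"
    "HOL-Algebra.Chinese_Remainder"
    "HOL-Algebra.Algebraic_Closure_Type"
    "HOL-Number_Theory.Cong"
    "HOL-Analysis.Analysis"
begin

definition rat_matrix :: "int^2^2 \<Rightarrow> rat^2^2" where
  "rat_matrix A = map_matrix of_int A"

text \<open>Multiplication on the vector types is componentwise, so the overloaded power operation
  is not the matrix power.\<close>

definition matrix_powi :: "rat^2^2 \<Rightarrow> int \<Rightarrow> rat^2^2" where
  "matrix_powi B k =
     (if k \<ge> 0 then (((**) B) ^^ nat k) (mat 1)
      else (((**) (matrix_inv B)) ^^ nat (- k)) (mat 1))"

definition G :: "int^2^2 \<Rightarrow> (rat^2) set" where
  "G A = {matrix_powi (rat_matrix A) k *v x | k x. \<forall>i. x $ i \<in> \<int>}"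

text \<open>Every group endomorphism of \<^term>\<open>G A\<close> is induced by a rational matrix, and the
  endomorphism ring is identified with the ring of those matrices.\<close>

definition EndG :: "int^2^2 \<Rightarrow> (rat^2^2) set" where
  "EndG A = {T. (\<lambda>x. T *v x) ` G A \<subseteq> G A}"

definition rat_matrix_ring :: "(rat^2^2) ring" where
  "rat_matrix_ring =
     \<lparr>carrier = UNIV, monoid.mult = (**), one = mat 1, ring.zero = 0, add = (+)\<rparr>"

definition EndG_ring :: "int^2^2 \<Rightarrow> (rat^2^2) ring" where
  "EndG_ring A = rat_matrix_ring\<lparr>carrier := EndG A\<rparr>"

definition Z_inverse :: "int \<Rightarrow> rat set" where
  "Z_inverse m = generate_ring ring_of_type_algebra {1 / of_int m}"

definition Z_inverse_ring :: "int \<Rightarrow> rat ring" where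
  "Z_inverse_ring m = ring_of_type_algebra\<lparr>carrier := Z_inverse m\<rparr>"

definition charpoly :: "int^2^2 \<Rightarrow> int poly" where
  "charpoly A = det (mat [:0, 1:] - map_matrix (\<lambda>a. [:a:]) A)"

definition primes_det :: "int^2^2 \<Rightarrow> int set" where
  "primes_det A = {p. Factorial_Ring.prime p \<and> p dvd det A}"

definition primes_det' :: "int^2^2 \<Rightarrow> int set" where
  "primes_det' A = {p \<in> primes_det A.
     \<not> (\<forall>i. [Polynomial.coeff (charpoly A) i = Polynomial.coeff [:0, 0, 1:] i] (mod p))}"

text \<open>At the units the empty product gives 1. Hence the hypothesis that the radical of m does not
  divide the radical of n excludes that m is a unit.\<close>

definition rad :: "int \<Rightarrow> int" where
  "rad m = \<Prod>(prime_factors m)"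

definition diag2 :: "rat \<Rightarrow> rat \<Rightarrow> rat^2^2" where
  "diag2 a b = vector [vector [a, 0], vector [0, b]]"

definition centralizer_over :: "rat set \<Rightarrow> rat^2^2 \<Rightarrow> (rat^2^2) set" where
  "centralizer_over R B = {T. (\<forall>i j. T $ i $ j \<in> R) \<and> T ** B = B ** T}"

end

theory Submission
  imports Defs
begin

text \<open>
  In the eigenbasis given by the columns of M, a vector of the plane lies in G A exactly when some
  power of A makes it integral. If p divides l1 but not l2, the elements of G A that are
  infinitely p-divisible in G A are those on the first eigenline; hence every endomorphism preserves
  that line, and by symmetry the other one, so it is conjugate by M to a diagonal matrix diag(x1, x2).
  Such a matrix is an endomorphism iff its product with some power of A is integral, that is, iff for
  some k the numbers n1 = l1^k x1 and n2 = l2^k x2 are integers that are congruent modulo v. As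
  l1 and l2 are congruent modulo v, (l1 l2)^k (x1 - x2) is congruent to l1^k (n1 - n2), which
  translates this condition into the one on (x1 - x2) / v.
\<close>

section \<open>The ring generated by the inverse of an integer\<close>

lemma rat_algebra_simps [simp]:
  "carrier (ring_of_type_algebra :: rat ring) = UNIV"
  "x \<oplus>\<^bsub>ring_of_type_algebra :: rat ring\<^esub> y = x + y"
  "x \<otimes>\<^bsub>ring_of_type_algebra :: rat ring\<^esub> y = x * y"
  "\<one>\<^bsub>ring_of_type_algebra :: rat ring\<^esub> = 1"
  "\<zero>\<^bsub>ring_of_type_algebra :: rat ring\<^esub> = 0"
  by (simp_all add: ring_of_type_algebra_def)

lemma cring_rat_algebra: "cring (ring_of_type_algebra :: rat ring)"
  by (rule cring_from_type_algebra)

lemma ring_rat_algebra: "ring (ring_of_type_algebra :: rat ring)"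
  using cring_rat_algebra by (rule cring.axioms(1))

lemma rat_algebra_a_inv [simp]: "\<ominus>\<^bsub>ring_of_type_algebra :: rat ring\<^esub> x = - x"
proof -
  interpret ring "ring_of_type_algebra :: rat ring" by (rule ring_rat_algebra)
  show ?thesis by (rule minus_equality) auto
qed

lemma subring_Z_inverse: "subring (Z_inverse m) (ring_of_type_algebra :: rat ring)"
  unfolding Z_inverse_def
  by (rule ring.generate_ring_is_subring[OF ring_rat_algebra]) simp

lemma Z_inverse_closed:
  shows one_in_Z_inverse: "1 \<in> Z_inverse m"
    and zero_in_Z_inverse: "0 \<in> Z_inverse m"
    and uminus_in_Z_inverse: "x \<in> Z_inverse m \<Longrightarrow> - x \<in> Z_inverse m"
    and add_in_Z_inverse: "x \<in> Z_inverse m \<Longrightarrow> y \<in> Z_inverse m \<Longrightarrow> x + y \<in> Z_inverse m"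
    and mult_in_Z_inverse: "x \<in> Z_inverse m \<Longrightarrow> y \<in> Z_inverse m \<Longrightarrow> x * y \<in> Z_inverse m"
  using subringE[OF subring_Z_inverse[of m]] by auto

lemma of_int_in_Z_inverse: "of_int n \<in> Z_inverse m"
proof (induction n rule: int_induct[of _ 0])
  case base
  show ?case by (simp add: Z_inverse_closed)
next
  case (step1 i)
  then show ?case by (simp add: Z_inverse_closed)
next
  case (step2 i)
  then have "of_int i + (- 1) \<in> Z_inverse m" by (intro Z_inverse_closed)
  then show ?case by simp
qed

text \<open>The numbers cleared by some power of \<open>m\<close> include \<open>1 / m\<close> and
  are closed under sums and products, as exponents can be added; conversely n / m^k is built from
  ring elements. This replaces the inductive generation by a search for exponents.\<close>

lemma Z_inverse_iff:
  assumes "m \<noteq> 0"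
  shows "x \<in> Z_inverse m \<longleftrightarrow> (\<exists>k. of_int m ^ k * x \<in> \<int>)"
proof
  assume "x \<in> Z_inverse m"
  then show "\<exists>k. of_int m ^ k * x \<in> \<int>"
    unfolding Z_inverse_def
  proof (induction rule: generate_ring.induct)
    case one
    show ?case by (intro exI[of _ 0]) simp
  next
    case (incl h)
    then show ?case using assms by (intro exI[of _ 1]) simp
  next
    case (a_inv h)
    then show ?case by auto
  next
    case (eng_add x y)
    then obtain j k where "of_int m ^ j * x \<in> \<int>" "of_int m ^ k * y \<in> \<int>" by blast
    then have "of_int m ^ k * (of_int m ^ j * x) + of_int m ^ j * (of_int m ^ k * y) \<in> \<int>"
      by (simp add: Ints_add Ints_mult)
    then have "of_int m ^ (j + k) * (x + y) \<in> \<int>"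
      by (simp add: power_add algebra_simps)
    then show ?case by auto
  next
    case (eng_mult x y)
    then obtain j k where "of_int m ^ j * x \<in> \<int>" "of_int m ^ k * y \<in> \<int>" by blast
    then have "(of_int m ^ j * x) * (of_int m ^ k * y) \<in> \<int>"
      by (rule Ints_mult)
    then have "of_int m ^ (j + k) * (x * y) \<in> \<int>"
      by (simp add: power_add algebra_simps)
    then show ?case by auto
  qed
next
  assume "\<exists>k. of_int m ^ k * x \<in> \<int>"
  then obtain k n where n: "of_int m ^ k * x = of_int n" by (auto elim: Ints_cases)
  have inv: "1 / of_int m \<in> Z_inverse m"
    unfolding Z_inverse_def by (rule generate_ring.incl) simp
  have "(1 / of_int m) ^ j \<in> Z_inverse m" for j
    by (induction j) (simp_all only: power_0 power_Suc one_in_Z_inverse mult_in_Z_inverse inv)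
  then have "(1 / of_int m) ^ k * of_int n \<in> Z_inverse m"
    by (intro mult_in_Z_inverse of_int_in_Z_inverse)
  also have "(1 / of_int m) ^ k * of_int n = x"
    using n[symmetric] assms by (simp add: power_divide)
  finally show "x \<in> Z_inverse m" .
qed

lemma Z_inverse_mult_mono:
  assumes "m * n \<noteq> 0" and "x \<in> Z_inverse m"
  shows "x \<in> Z_inverse (m * n)"
proof -
  obtain k where "of_int m ^ k * x \<in> \<int>"
    using assms by (auto simp: Z_inverse_iff)
  then have "of_int n ^ k * (of_int m ^ k * x) \<in> \<int>" by (simp add: Ints_mult)
  then have "of_int (m * n) ^ k * x \<in> \<int>" by (simp add: power_mult_distrib mult_ac)
  then show ?thesis using assms(1) Z_inverse_iff by blast
qed

section \<open>The product of two such rings\<close>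

lemma cring_Z_inverse_ring: "cring (Z_inverse_ring m)"
  unfolding Z_inverse_ring_def
  using cring.subcringI'[OF cring_rat_algebra subring_Z_inverse]
    ring.subcring_iff[OF ring_rat_algebra] by simp

lemma RDirProd_Z_inverse_simps [simp]:
  "carrier (RDirProd (Z_inverse_ring m) (Z_inverse_ring n)) = Z_inverse m \<times> Z_inverse n"
  "p \<oplus>\<^bsub>RDirProd (Z_inverse_ring m) (Z_inverse_ring n)\<^esub> q = (fst p + fst q, snd p + snd q)"
  "p \<otimes>\<^bsub>RDirProd (Z_inverse_ring m) (Z_inverse_ring n)\<^esub> q = (fst p * fst q, snd p * snd q)"
  "\<one>\<^bsub>RDirProd (Z_inverse_ring m) (Z_inverse_ring n)\<^esub> = (1, 1)"
  "\<zero>\<^bsub>RDirProd (Z_inverse_ring m) (Z_inverse_ring n)\<^esub> = (0, 0)"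
  by (simp_all add: RDirProd_def DirProd_def monoid.defs Z_inverse_ring_def case_prod_beta)

lemma cring_RDirProd_Z_inverse: "cring (RDirProd (Z_inverse_ring m) (Z_inverse_ring n))"
proof -
  interpret ring "RDirProd (Z_inverse_ring m) (Z_inverse_ring n)"
    by (intro RDirProd_ring cring.axioms(1) cring_Z_inverse_ring)
  show ?thesis by unfold_locales (auto simp: mult.commute)
qed

lemma RDirProd_Z_inverse_a_inv:
  assumes "x \<in> Z_inverse m" "y \<in> Z_inverse n"
  shows "\<ominus>\<^bsub>RDirProd (Z_inverse_ring m) (Z_inverse_ring n)\<^esub> (x, y) = (- x, - y)"
proof -
  interpret cring "RDirProd (Z_inverse_ring m) (Z_inverse_ring n)"
    by (rule cring_RDirProd_Z_inverse)
  show ?thesis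
    by (rule minus_equality) (use assms in \<open>auto simp: Z_inverse_closed\<close>)
qed

section \<open>Arithmetic preliminaries\<close>

text \<open>By contraposition: an inclusion between the sets of prime factors would make one product
  divide the other. The resulting prime separates the two eigenvalues.\<close>

lemma prime_not_dvd_of_rad_not_dvd:
  assumes "m \<noteq> 0" "n \<noteq> 0" "\<not> rad m dvd rad n"
  obtains p :: int where "Factorial_Ring.prime p" "p dvd m" "\<not> p dvd n"
proof -
  have "\<not> prime_factors m \<subseteq> prime_factors n"
  proof
    assume "prime_factors m \<subseteq> prime_factors n"
    then have "rad m dvd rad n"
      unfolding rad_def by (intro prod_dvd_prod_subset) auto
    with assms(3) show False by blast
  qed
  then obtain p where "p \<in> prime_factors m" "p \<notin> prime_factors n" by blast
  then show thesis using that[of p] assms(1,2) by (auto simp: in_prime_factors_iff)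
qed

text \<open>Powers of \<open>b\<close> cannot cancel any factor \<open>p\<close>, so every power of
  \<open>p\<close> has to divide the numerator of \<open>t\<close>. This is how linear conditions on
  the entries of an endomorphism are obtained.\<close>

lemma eq_0_if_power_divides_all:
  fixes t :: rat and p b :: int
  assumes p: "Factorial_Ring.prime p" and "\<not> p dvd b"
    and div: "\<And>n. \<exists>k. of_int b ^ k * t / of_int p ^ n \<in> \<int>"
  shows "t = 0"
proof -
  obtain a c where t: "t = of_int a / of_int c" and c: "c > 0"
    by (metis quotient_of_denom_pos' quotient_of_div surj_pair snd_conv)
  have p0: "p \<noteq> 0" and p2: "p \<ge> 2" using p by (auto simp: prime_ge_2_int)
  have dvd: "p ^ n dvd a" for n
  proof -
    obtain k z where "of_int b ^ k * t / of_int p ^ n = of_int z"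
      using div[of n] by (auto elim: Ints_cases)
    then have "of_int b ^ k * of_int a = (of_int p ^ n * of_int c * of_int z :: rat)"
      using c p0 by (simp add: t field_simps)
    then have "of_int (b ^ k * a) = (of_int (p ^ n * (c * z)) :: rat)"
      by (simp add: mult_ac)
    then have "p ^ n dvd b ^ k * a" by (simp only: of_int_eq_iff) simp
    moreover have "coprime (p ^ n) (b ^ k)"
      using p \<open>\<not> p dvd b\<close> by (simp add: prime_imp_coprime)
    ultimately show ?thesis by (simp add: coprime_dvd_mult_right_iff)
  qed
  have "a = 0"
  proof (rule ccontr)
    assume "a \<noteq> 0"
    \<comment> \<open>This exponent is already too large: |a| < 2^|a| \<le> p^|a|.\<close>
    define n where "n = nat \<bar>a\<bar>"
    have "p ^ n \<le> \<bar>a\<bar>" using dvd[of n] \<open>a \<noteq> 0\<close> by (metis dvd_imp_le_int abs_ge_self order_trans)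
    moreover have "int n < 2 ^ n" by simp
    moreover have "(2::int) ^ n \<le> p ^ n" using p2 by (intro power_mono) auto
    ultimately show False unfolding n_def by linarith
  qed
  then show ?thesis by (simp add: t)
qed

section \<open>Matrices with two fixed rational eigenlines\<close>

text \<open>The matrix with eigenvector (1, 0) for x and eigenvector (u, v) for y.\<close>

definition eig_matrix :: "rat \<Rightarrow> rat \<Rightarrow> rat \<Rightarrow> rat \<Rightarrow> rat^2^2" where
  "eig_matrix u v x y = vector [vector [x, u * (y - x) / v], vector [0, y]]"

lemma eig_matrix_nth [simp]:
  "eig_matrix u v x y $ 1 $ 1 = x" "eig_matrix u v x y $ 1 $ 2 = u * (y - x) / v"
  "eig_matrix u v x y $ 2 $ 1 = 0" "eig_matrix u v x y $ 2 $ 2 = y"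
  by (simp_all add: eig_matrix_def)

lemma eig_matrix_inject: "eig_matrix u v x y = eig_matrix u v x' y' \<longleftrightarrow> x = x' \<and> y = y'"
  by (metis eig_matrix_nth(1,4))

text \<open>All these matrices share the eigenvectors (1, 0) and (u, v), so only the eigenvalues
  multiply. For \<open>v = 0\<close> division returns 0 and the matrices are diagonal.\<close>

lemma eig_matrix_mult: "eig_matrix u v x y ** eig_matrix u v x' y' = eig_matrix u v (x * x') (y * y')"
  by (cases "v = 0") (simp_all add: vec_eq_iff forall_2 matrix_matrix_mult_def sum_2 field_simps)

lemma eig_matrix_add: "eig_matrix u v x y + eig_matrix u v x' y' = eig_matrix u v (x + x') (y + y')"
  by (cases "v = 0") (simp_all add: vec_eq_iff forall_2 field_simps)

lemma eig_matrix_1: "eig_matrix u v 1 1 = mat 1"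
  by (simp add: vec_eq_iff forall_2 mat_def)

lemma eig_matrix_0: "eig_matrix u v 0 0 = 0"
  by (simp add: vec_eq_iff forall_2)

lemma eig_matrix_mult_vec:
  "(eig_matrix u v x y *v w) $ 1 = x * w $ 1 + u * (y - x) / v * w $ 2"
  "(eig_matrix u v x y *v w) $ 2 = y * w $ 2"
  by (simp_all add: matrix_vector_mult_def sum_2)

text \<open>\<open>matrix_inv\<close> is a choice among two-sided inverses; their uniqueness
  determines its value.\<close>

lemma matrix_inv_eqI:
  fixes B C :: "'a::semiring_1^'n^'n"
  assumes "B ** C = mat 1" "C ** B = mat 1"
  shows "matrix_inv B = C"
proof -
  have "B ** matrix_inv B = mat 1 \<and> matrix_inv B ** B = mat 1"
    unfolding matrix_inv_def by (rule someI[of _ C]) (use assms in simp)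
  then show ?thesis
    by (metis assms(1) matrix_mul_assoc matrix_mul_lid matrix_mul_rid)
qed

text \<open>The columns of \<open>M\<close> are the common eigenvectors. From here on,
  \<open>M\<close> is replaced by the explicit triangular form.\<close>

lemma conj_diag2_eq_eig_matrix:
  assumes "v \<noteq> 0" and M: "M = vector [vector [1, u], vector [0, v]]"
  shows "M ** diag2 x y ** matrix_inv M = eig_matrix u v x y"
proof -
  have inv: "matrix_inv M = vector [vector [1, - u / v], vector [0, 1 / v]]"
    by (rule matrix_inv_eqI)
       (use assms in \<open>simp_all add: vec_eq_iff forall_2 matrix_matrix_mult_def sum_2 mat_def\<close>)
  show ?thesis unfolding inv unfolding M using assms(1)
    by (simp add: diag2_def vec_eq_iff forall_2 matrix_matrix_mult_def sum_2 field_simps)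
qed

lemma matrix_powi_eig_matrix:
  assumes "x \<noteq> 0" "y \<noteq> 0"
  shows "matrix_powi (eig_matrix u v x y) k = eig_matrix u v (x powi k) (y powi k)"
proof -
  have pow: "((**) (eig_matrix u v a b) ^^ n) (mat 1) = eig_matrix u v (a ^ n) (b ^ n)" for a b n
    by (induction n) (simp_all add: eig_matrix_1 eig_matrix_mult)
  have inv: "matrix_inv (eig_matrix u v x y) = eig_matrix u v (inverse x) (inverse y)"
    by (rule matrix_inv_eqI) (use assms in \<open>simp_all add: eig_matrix_mult eig_matrix_1\<close>)
  show ?thesis unfolding matrix_powi_def inv pow by (simp add: power_int_def)
qed

text \<open>Comparing entries makes the integer matrix itself upper triangular. This identifies the
  ring generated by the inverse of \<open>det A\<close> with
  \<open>Z_inverse (l1 * l2)\<close>.\<close>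

lemma det_eq_if_rat_matrix_eq_eig_matrix:
  assumes "rat_matrix A = eig_matrix u v (of_int x) (of_int y)"
  shows "det A = x * y"
proof -
  have "rat_matrix A $ i $ j = of_int (A $ i $ j)" for i j
    by (simp add: rat_matrix_def map_matrix_def)
  then have "of_int (A $ 1 $ 1) = (of_int x :: rat)" "of_int (A $ 2 $ 1) = (0 :: rat)"
    "of_int (A $ 2 $ 2) = (of_int y :: rat)"
    unfolding assms by (metis eig_matrix_nth)+
  then show ?thesis by (simp add: det_2)
qed

section \<open>The group and its endomorphisms\<close>

text \<open>The eigenvalue data are fixed here; the primes that separate \<open>l1\<close> from
  \<open>l2\<close> are passed explicitly to the lemmas on eigenlines.\<close>

locale split_matrix =
  fixes l1 l2 u v :: int and A :: "int^2^2"
  assumes coprime_uv: "gcd u v = 1" and v0: "v \<noteq> 0" and v_dvd: "v dvd l1 - l2"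
    and l1: "l1 \<noteq> 0" and l2: "l2 \<noteq> 0"
    and A_eq: "rat_matrix A = eig_matrix (of_int u) (of_int v) (of_int l1) (of_int l2)"
begin

abbreviation E :: "rat \<Rightarrow> rat \<Rightarrow> rat^2^2" where
  "E \<equiv> eig_matrix (of_int u) (of_int v)"

lemma v_dvd_power_diff: "v dvd l1 ^ k - l2 ^ k"
proof -
  have "l1 - l2 dvd l1 ^ k - l2 ^ k" by (metis dvd_triv_left power_diff_sumr2)
  with v_dvd show ?thesis by (rule dvd_trans)
qed

text \<open>Nonnegative powers of \<open>A\<close> preserve the integer lattice: \<open>v\<close>
  divides l2^k - l1^k, so the upper right entry is integral.\<close>

lemma integral_power_mult_vec:
  fixes x :: "rat^2"
  assumes "\<forall>i. x $ i \<in> \<int>"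
  shows "\<forall>i. (E (of_int l1 ^ k) (of_int l2 ^ k) *v x) $ i \<in> \<int>"
proof -
  obtain c where c: "l2 ^ k - l1 ^ k = v * c"
    using v_dvd_power_diff by (metis dvd_def dvd_diff_commute)
  have "of_int l2 ^ k - of_int l1 ^ k = (of_int (v * c) :: rat)"
    unfolding c[symmetric] by simp
  then have "of_int u * (of_int l2 ^ k - of_int l1 ^ k) / of_int v = (of_int (u * c) :: rat)"
    using v0 by simp
  then show ?thesis using assms
    by (auto simp: forall_2 eig_matrix_mult_vec intro!: Ints_add Ints_mult)
qed

text \<open>If w = A^k x with x integral, then w is itself integral when k \<ge> 0, and otherwise
  A^(-k) w = x. Thus natural exponents suffice to test membership.\<close>

lemma mem_G_iff:
  "w \<in> G A \<longleftrightarrow> (\<exists>k. \<forall>i. (E (of_int l1 ^ k) (of_int l2 ^ k) *v w) $ i \<in> \<int>)"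
proof
  assume "w \<in> G A"
  then obtain k and x :: "rat^2" where w: "w = E (of_int l1 powi k) (of_int l2 powi k) *v x"
    and x: "\<forall>i. x $ i \<in> \<int>"
    using l1 l2 by (auto simp: G_def A_eq matrix_powi_eig_matrix)
  show "\<exists>k. \<forall>i. (E (of_int l1 ^ k) (of_int l2 ^ k) *v w) $ i \<in> \<int>"
  proof (cases "k \<ge> 0")
    case True
    then have "w = E (of_int l1 ^ nat k) (of_int l2 ^ nat k) *v x"
      using w by (simp add: power_int_def)
    then have "\<forall>i. w $ i \<in> \<int>" using integral_power_mult_vec[OF x] by metis
    then show ?thesis by (intro exI[of _ 0]) (simp add: eig_matrix_1)
  next
    case False
    then have "E (of_int l1 ^ nat (- k)) (of_int l2 ^ nat (- k)) *v w = x"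
      using l1 l2 by (simp add: w matrix_vector_mul_assoc eig_matrix_mult eig_matrix_1
          power_int_def flip: power_mult_distrib)
    then show ?thesis using x by metis
  qed
next
  assume "\<exists>k. \<forall>i. (E (of_int l1 ^ k) (of_int l2 ^ k) *v w) $ i \<in> \<int>"
  then obtain k where k: "\<forall>i. (E (of_int l1 ^ k) (of_int l2 ^ k) *v w) $ i \<in> \<int>" ..
  have "w = E (of_int l1 powi - int k) (of_int l2 powi - int k) *v
      (E (of_int l1 ^ k) (of_int l2 ^ k) *v w)"
    using l1 l2 by (simp add: matrix_vector_mul_assoc eig_matrix_mult eig_matrix_1
          power_int_minus)
  then show "w \<in> G A"
    unfolding G_def A_eq using k l1 l2 by (auto simp: matrix_powi_eig_matrix simp del: power_int_minus)
qed

text \<open>Holding for all large exponents, integrality can be used for several vectors with one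
  common exponent.\<close>

lemma mem_G_eventually:
  assumes "w \<in> G A"
  obtains k0 where "\<And>k. k \<ge> k0 \<Longrightarrow> \<forall>i. (E (of_int l1 ^ k) (of_int l2 ^ k) *v w) $ i \<in> \<int>"
proof -
  obtain k0 where k0: "\<forall>i. (E (of_int l1 ^ k0) (of_int l2 ^ k0) *v w) $ i \<in> \<int>"
    using assms unfolding mem_G_iff by blast
  have "\<forall>i. (E (of_int l1 ^ k) (of_int l2 ^ k) *v w) $ i \<in> \<int>" if "k \<ge> k0" for k
    using integral_power_mult_vec[OF k0, of "k - k0"] that
    by (simp add: matrix_vector_mul_assoc eig_matrix_mult flip: power_add)
  then show thesis using that by blast
qed

lemma integral_mem_G: "\<forall>i. w $ i \<in> \<int> \<Longrightarrow> w \<in> G A"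
  unfolding mem_G_iff by (intro exI[of _ 0]) (simp add: eig_matrix_1)

section \<open>Endomorphisms that are diagonal in the eigenbasis\<close>

lemma EndG_mult_vec: "T \<in> EndG A \<Longrightarrow> w \<in> G A \<Longrightarrow> T *v w \<in> G A"
  unfolding EndG_def by auto

text \<open>Testing T = \<open>E x1 x2\<close> on the standard basis makes A^k T integral for some
  k. Conversely, T commutes with \<open>A\<close>, so integrality of A^k T carries every vector of
  \<open>G A\<close> back into \<open>G A\<close>.\<close>

lemma E_mem_EndG_iff:
  "E x1 x2 \<in> EndG A \<longleftrightarrow>
     (\<exists>k. of_int l1 ^ k * x1 \<in> \<int> \<and> of_int l2 ^ k * x2 \<in> \<int>
        \<and> (of_int l1 ^ k * x1 - of_int l2 ^ k * x2) / of_int v \<in> \<int>)"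
  (is "_ \<longleftrightarrow> (\<exists>k. ?P k)")
proof
  assume T: "E x1 x2 \<in> EndG A"
  have "E x1 x2 *v vector [1, 0] \<in> G A" "E x1 x2 *v vector [0, 1] \<in> G A"
    by (rule EndG_mult_vec[OF T], rule integral_mem_G, simp add: forall_2)+
  then obtain k1 k2 where
    k1: "\<And>k. k \<ge> k1 \<Longrightarrow> \<forall>i. (E (of_int l1 ^ k) (of_int l2 ^ k) *v (E x1 x2 *v vector [1, 0])) $ i \<in> \<int>"
    and k2: "\<And>k. k \<ge> k2 \<Longrightarrow> \<forall>i. (E (of_int l1 ^ k) (of_int l2 ^ k) *v (E x1 x2 *v vector [0, 1])) $ i \<in> \<int>"
    by (elim mem_G_eventually) blast
  define k where "k = max k1 k2"
  define n1 where "n1 = of_int l1 ^ k * x1"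
  define n2 where "n2 = of_int l2 ^ k * x2"
  have "n1 \<in> \<int>" "n2 \<in> \<int>" and *: "of_int u * (n2 - n1) / of_int v \<in> \<int>"
    using k1[of k] k2[of k]
    by (simp_all add: k_def n1_def n2_def matrix_vector_mul_assoc eig_matrix_mult
        forall_2 eig_matrix_mult_vec)
  \<comment> \<open>The off-diagonal entry only gives integrality of u (n2 - n1) / v. A Bezout
    relation removes the factor \<open>u\<close>, writing (n1 - n2) / v as an integer combination of
    that entry and n1 - n2.\<close>
  obtain r s where "r * u + s * v = gcd u v" using bezout_int by blast
  then have "of_int (r * u + s * v) = (1 :: rat)" using coprime_uv by simp
  then have "(n1 - n2) / of_int v = (of_int r * of_int u + of_int s * of_int v) * ((n1 - n2) / of_int v)"
    by simp
  also have "\<dots> = of_int s * (n1 - n2) - of_int r * (of_int u * (n2 - n1) / of_int v)"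
    using v0 by (simp add: field_simps)
  also have "\<dots> \<in> \<int>"
    using * \<open>n1 \<in> \<int>\<close> \<open>n2 \<in> \<int>\<close> by (intro Ints_diff Ints_mult Ints_of_int)
  finally have "?P k"
    using \<open>n1 \<in> \<int>\<close> \<open>n2 \<in> \<int>\<close> unfolding n1_def n2_def by blast
  then show "\<exists>k. ?P k" ..
next
  assume "\<exists>k. ?P k"
  then obtain k where k: "?P k" ..
  have "E x1 x2 *v w \<in> G A" if w: "w \<in> G A" for w
  proof -
    obtain j where j: "\<forall>i. (E (of_int l1 ^ j) (of_int l2 ^ j) *v w) $ i \<in> \<int>"
      using w unfolding mem_G_iff by blast
    define z where "z = E (of_int l1 ^ j) (of_int l2 ^ j) *v w"
    have z: "z $ 1 \<in> \<int>" "z $ 2 \<in> \<int>" using j unfolding z_def by blast+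
    have "of_int u * (of_int l2 ^ k * x2 - of_int l1 ^ k * x1) / of_int v
        = - (of_int u * ((of_int l1 ^ k * x1 - of_int l2 ^ k * x2) / of_int v))"
      using v0 by (simp add: field_simps)
    also have "\<dots> \<in> \<int>" using k by (intro Ints_minus Ints_mult) auto
    finally have "\<forall>i. (E (of_int l1 ^ k * x1) (of_int l2 ^ k * x2) *v z) $ i \<in> \<int>"
      using z k unfolding forall_2 eig_matrix_mult_vec by (metis Ints_add Ints_mult)
    \<comment> \<open>Commuting past T, the power A^j hidden in \<open>z\<close> joins A^k, so
      exponent \<open>k + j\<close> witnesses membership of the image.\<close>
    moreover have "E (of_int l1 ^ k * x1) (of_int l2 ^ k * x2) *v z
        = E (of_int l1 ^ (k + j)) (of_int l2 ^ (k + j)) *v (E x1 x2 *v w)"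
      by (simp add: z_def matrix_vector_mul_assoc eig_matrix_mult power_add mult_ac)
    ultimately show ?thesis unfolding mem_G_iff by metis
  qed
  then show "E x1 x2 \<in> EndG A" unfolding EndG_def by auto
qed

text \<open>With n1 = l1^k x1 and n2 = l2^k x2, the number (l1 l2)^k (x1 - x2) equals l2^k n1 - l1^k
  n2. Since l1^k and l2^k agree modulo \<open>v\<close>, its divisibility by \<open>v\<close> can be
  compared with that of a difference of the scaled eigenvalues.\<close>

lemma integral_congruence_iff:
  "(\<exists>k. of_int l1 ^ k * x1 \<in> \<int> \<and> of_int l2 ^ k * x2 \<in> \<int>
        \<and> (of_int l1 ^ k * x1 - of_int l2 ^ k * x2) / of_int v \<in> \<int>) \<longleftrightarrow>
     x1 \<in> Z_inverse l1 \<and> x2 \<in> Z_inverse l2 \<and> (x1 - x2) / of_int v \<in> Z_inverse (l1 * l2)"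
  (is "(\<exists>k. ?P k) \<longleftrightarrow> ?R")
proof
  assume "\<exists>k. ?P k"
  then obtain k where k: "?P k" ..
  define n1 where "n1 = of_int l1 ^ k * x1"
  define n2 where "n2 = of_int l2 ^ k * x2"
  obtain c where c: "l1 ^ k - l2 ^ k = v * c"
    using v_dvd_power_diff by (metis dvd_def)
  have c': "of_int l1 ^ k = of_int l2 ^ k + (of_int v * of_int c :: rat)"
    using arg_cong[OF c, of "of_int :: int \<Rightarrow> rat"] by simp
  have "of_int (l1 * l2) ^ k * ((x1 - x2) / of_int v) = (of_int l2 ^ k * n1 - of_int l1 ^ k * n2) / of_int v"
    by (simp add: n1_def n2_def power_mult_distrib algebra_simps diff_divide_distrib)
  also have "\<dots> = of_int l2 ^ k * ((n1 - n2) / of_int v) - of_int c * n2"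
    unfolding c' using v0 by (simp add: field_simps)
  also have "\<dots> \<in> \<int>"
    using k unfolding n1_def[symmetric] n2_def[symmetric] by (intro Ints_diff Ints_mult) auto
  finally show ?R using k l1 l2 by (auto simp: Z_inverse_iff simp del: of_int_mult)
next
  assume ?R
  then obtain i j m where *: "of_int l1 ^ i * x1 \<in> \<int>" "of_int l2 ^ j * x2 \<in> \<int>"
    "of_int (l1 * l2) ^ m * ((x1 - x2) / of_int v) \<in> \<int>"
    using l1 l2 by (auto simp: Z_inverse_iff simp del: of_int_mult)
  have raise: "of_int b ^ n * y \<in> \<int>" if "of_int b ^ i * y \<in> \<int>" "i \<le> n" for b i n and y :: rat
  proof -
    have "of_int b ^ (n - i) * (of_int b ^ i * y) \<in> \<int>" using that(1) by (simp add: Ints_mult)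
    moreover have "of_int b ^ n = of_int b ^ (n - i) * (of_int b ^ i :: rat)"
      using that(2) by (simp flip: power_add)
    ultimately show ?thesis by (simp add: mult.assoc)
  qed
  \<comment> \<open>One exponent serving all three integrality conditions.\<close>
  define k where "k = max i (max j m)"
  define n1 where "n1 = of_int l1 ^ k * x1"
  define n2 where "n2 = of_int l2 ^ k * x2"
  have n: "n1 \<in> \<int>" "n2 \<in> \<int>" "of_int (l1 * l2) ^ k * ((x1 - x2) / of_int v) \<in> \<int>"
    unfolding n1_def n2_def by (rule raise[OF *(1)] raise[OF *(2)] raise[OF *(3)], simp add: k_def)+
  obtain c where c: "l1 ^ k - l2 ^ k = v * c"
    using v_dvd_power_diff by (metis dvd_def)
  have c': "of_int l1 ^ k = of_int l2 ^ k + (of_int v * of_int c :: rat)"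
    using arg_cong[OF c, of "of_int :: int \<Rightarrow> rat"] by simp
  have eq: "of_int (l1 * l2) ^ k * ((x1 - x2) / of_int v) = (of_int l2 ^ k * n1 - of_int l1 ^ k * n2) / of_int v"
    by (simp add: n1_def n2_def power_mult_distrib algebra_simps diff_divide_distrib)
  \<comment> \<open>Exchanging l1^k and l2^k changes the numerator by v c (n1 + n2). The new
    numerator is l1^(2k) x1 - l2^(2k) x2, which is why the witness is \<open>k + k\<close>.\<close>
  have "(of_int l1 ^ k * n1 - of_int l2 ^ k * n2) / of_int v
      = (of_int l2 ^ k * n1 - of_int l1 ^ k * n2) / of_int v + of_int c * (n1 + n2)"
    unfolding c' using v0 by (simp add: field_simps)
  also have "\<dots> \<in> \<int>"
    using n unfolding eq[symmetric] by (metis Ints_add Ints_mult Ints_of_int)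
  finally have "(of_int l1 ^ (k + k) * x1 - of_int l2 ^ (k + k) * x2) / of_int v \<in> \<int>"
    by (simp add: n1_def n2_def power_add mult_ac)
  moreover have "of_int l1 ^ (k + k) * x1 \<in> \<int>" "of_int l2 ^ (k + k) * x2 \<in> \<int>"
    using n(1,2) unfolding n1_def n2_def by (auto intro: raise)
  ultimately show "\<exists>k. ?P k" by blast
qed

section \<open>Invariance of the two eigenlines\<close>

lemma EndG_lower_left_zero:
  fixes T :: "rat^2^2"
  assumes T: "T \<in> EndG A" and p: "Factorial_Ring.prime p" "p dvd l1" "\<not> p dvd l2"
  shows "T $ 2 $ 1 = 0"
proof (rule eq_0_if_power_divides_all[OF p(1,3)])
  fix n
  have p0: "p \<noteq> 0" using p by auto
  obtain c where c: "l1 = p * c" using p by blast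
  \<comment> \<open>A^n scales this eigenvector by l1^n, a multiple of p^n. The second coordinate of
    its image under \<open>T\<close> is scaled only by powers of \<open>l2\<close>, which are prime
    to \<open>p\<close>, and so must vanish.\<close>
  have "vector [1 / of_int p ^ n, 0] \<in> G A"
    unfolding mem_G_iff using p0
    by (intro exI[of _ n]) (simp add: forall_2 eig_matrix_mult_vec c power_mult_distrib)
  from EndG_mult_vec[OF T this] show "\<exists>k. of_int l2 ^ k * T $ 2 $ 1 / of_int p ^ n \<in> \<int>"
    unfolding mem_G_iff
    by (auto simp: forall_2 eig_matrix_mult_vec matrix_vector_mult_def sum_2)
qed

text \<open>The stated equation says that T (u, v) is again on the line through (u, v). That
  eigenvector can be divided by every q^n inside \<open>G A\<close>, while the linear form v x - u
  y, which vanishes on the line, is scaled by \<open>A\<close> with factor \<open>l1\<close>, prime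
  to \<open>q\<close>.\<close>

lemma EndG_second_eigenline:
  fixes T :: "rat^2^2"
  assumes T: "T \<in> EndG A" and q: "Factorial_Ring.prime q" "q dvd l2" "\<not> q dvd l1"
  shows "of_int v * (T $ 1 $ 1 * of_int u + T $ 1 $ 2 * of_int v)
    = of_int u * (T $ 2 $ 1 * of_int u + T $ 2 $ 2 * of_int v)"
proof -
  define s where "s = T $ 1 $ 1 * of_int u + T $ 1 $ 2 * of_int v"
  define t where "t = T $ 2 $ 1 * of_int u + T $ 2 $ 2 * of_int v"
  have "of_int v * s - of_int u * t = 0"
  proof (rule eq_0_if_power_divides_all[OF q(1,3)])
    fix n
    have q0: "q \<noteq> 0" using q by auto
    obtain c where c: "l2 = q * c" using q by blast
    have "vector [of_int u / of_int q ^ n, of_int v / of_int q ^ n] \<in> G A"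
      unfolding mem_G_iff using q0 v0
      by (intro exI[of _ n]) (simp add: forall_2 eig_matrix_mult_vec c power_mult_distrib field_simps)
    from EndG_mult_vec[OF T this] obtain k where
      k: "\<forall>i. (E (of_int l1 ^ k) (of_int l2 ^ k) *v
        (T *v vector [of_int u / of_int q ^ n, of_int v / of_int q ^ n])) $ i \<in> \<int>"
      unfolding mem_G_iff by blast
    have "(T *v vector [of_int u / of_int q ^ n, of_int v / of_int q ^ n]) $ 1 = s / of_int q ^ n"
      "(T *v vector [of_int u / of_int q ^ n, of_int v / of_int q ^ n]) $ 2 = t / of_int q ^ n"
      by (simp_all add: matrix_vector_mult_def sum_2 s_def t_def add_divide_distrib)
    with k have k1: "of_int l1 ^ k * (s / of_int q ^ n)
        + of_int u * (of_int l2 ^ k - of_int l1 ^ k) / of_int v * (t / of_int q ^ n) \<in> \<int>" (is "?a \<in> _")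
      and k2: "of_int l2 ^ k * (t / of_int q ^ n) \<in> \<int>" (is "?b \<in> _")
      by (simp_all add: forall_2 eig_matrix_mult_vec)
    have "of_int l1 ^ k * (of_int v * s - of_int u * t) / of_int q ^ n = of_int v * ?a - of_int u * ?b"
      using q0 v0 by (simp add: field_simps)
    also have "\<dots> \<in> \<int>"
      by (rule Ints_diff[OF Ints_mult[OF Ints_of_int k1] Ints_mult[OF Ints_of_int k2]])
    finally show "\<exists>k. of_int l1 ^ k * (of_int v * s - of_int u * t) / of_int q ^ n \<in> \<int>" ..
  qed
  then show ?thesis by (simp add: s_def t_def)
qed

text \<open>Invariance of both eigenlines gives two linear equations: one kills the lower left
  entry, the other is solved for the upper right entry.\<close>

lemma EndG_eq_E:
  fixes T :: "rat^2^2"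
  assumes T: "T \<in> EndG A"
    and p: "Factorial_Ring.prime p" "p dvd l1" "\<not> p dvd l2"
    and q: "Factorial_Ring.prime q" "q dvd l2" "\<not> q dvd l1"
  shows "T = E (T $ 1 $ 1) (T $ 2 $ 2)"
proof -
  have zero: "T $ 2 $ 1 = 0" by (rule EndG_lower_left_zero[OF T p])
  have "of_int v * (T $ 1 $ 1 * of_int u + T $ 1 $ 2 * of_int v)
      = of_int v * (of_int u * T $ 2 $ 2)"
    using EndG_second_eigenline[OF T q] by (simp add: zero mult_ac)
  then have "T $ 1 $ 1 * of_int u + T $ 1 $ 2 * of_int v = of_int u * T $ 2 $ 2"
    using v0 by simp
  then have "T $ 1 $ 2 = of_int u * (T $ 2 $ 2 - T $ 1 $ 1) / of_int v"
    using v0 by (simp add: field_simps)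
  with zero show ?thesis by (simp add: vec_eq_iff forall_2)
qed

section \<open>The ring of admissible eigenvalue pairs\<close>

definition diag_pairs :: "(rat \<times> rat) set" where
  "diag_pairs = {(x1, x2). x1 \<in> Z_inverse l1 \<and> x2 \<in> Z_inverse l2
     \<and> (x1 - x2) / of_int v \<in> Z_inverse (l1 * l2)}"

lemma subring_diag_pairs:
  "subring diag_pairs (RDirProd (Z_inverse_ring l1) (Z_inverse_ring l2))"
proof -
  interpret cring "RDirProd (Z_inverse_ring l1) (Z_inverse_ring l2)"
    by (rule cring_RDirProd_Z_inverse)
  show ?thesis
  proof (rule subringI)
    show "diag_pairs \<subseteq> carrier (RDirProd (Z_inverse_ring l1) (Z_inverse_ring l2))"
      by (auto simp: diag_pairs_def)
    show "\<one>\<^bsub>RDirProd (Z_inverse_ring l1) (Z_inverse_ring l2)\<^esub> \<in> diag_pairs"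
      by (simp add: diag_pairs_def Z_inverse_closed)
  next
    fix h assume h: "h \<in> diag_pairs"
    obtain x y where xy: "h = (x, y)" by fastforce
    have "- ((x - y) / of_int v) \<in> Z_inverse (l1 * l2)"
      using h by (intro uminus_in_Z_inverse) (simp add: xy diag_pairs_def)
    then have "(- x - - y) / of_int v \<in> Z_inverse (l1 * l2)"
      by (simp add: minus_divide_left[symmetric] diff_divide_distrib)
    then show "\<ominus>\<^bsub>RDirProd (Z_inverse_ring l1) (Z_inverse_ring l2)\<^esub> h \<in> diag_pairs"
      using h by (simp add: xy diag_pairs_def RDirProd_Z_inverse_a_inv uminus_in_Z_inverse)
  next
    fix h h' assume h: "h \<in> diag_pairs" and h': "h' \<in> diag_pairs"
    obtain x y x' y' where xy: "h = (x, y)" "h' = (x', y')" by fastforce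
    have x: "x \<in> Z_inverse (l1 * l2)"
      using h l1 l2 by (intro Z_inverse_mult_mono) (auto simp: xy diag_pairs_def)
    have y': "y' \<in> Z_inverse (l1 * l2)"
      using h' l1 l2 Z_inverse_mult_mono[of l2 l1] by (simp add: xy diag_pairs_def mult.commute)
    \<comment> \<open>Closure under products rests on x x' - y y' = x (x' - y') + y' (x - y), with
      \<open>x\<close> and \<open>y'\<close> viewed in the larger ring
      \<open>Z_inverse (l1 * l2)\<close>.\<close>
    have "x * ((x' - y') / of_int v) + y' * ((x - y) / of_int v) \<in> Z_inverse (l1 * l2)"
      using h h' x y' by (intro add_in_Z_inverse mult_in_Z_inverse) (auto simp: xy diag_pairs_def)
    also have "x * ((x' - y') / of_int v) + y' * ((x - y) / of_int v) = (x * x' - y * y') / of_int v"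
      using v0 by (simp add: field_simps)
    finally show "h \<otimes>\<^bsub>RDirProd (Z_inverse_ring l1) (Z_inverse_ring l2)\<^esub> h' \<in> diag_pairs"
      using h h' by (simp add: xy diag_pairs_def mult_in_Z_inverse)
    have "(x' - y') / of_int v + (x - y) / of_int v \<in> Z_inverse (l1 * l2)"
      using h h' by (intro add_in_Z_inverse) (auto simp: xy diag_pairs_def)
    also have "(x' - y') / of_int v + (x - y) / of_int v = (x + x' - (y + y')) / of_int v"
      using v0 by (simp add: field_simps)
    finally show "h \<oplus>\<^bsub>RDirProd (Z_inverse_ring l1) (Z_inverse_ring l2)\<^esub> h' \<in> diag_pairs"
      using h h' by (simp add: xy diag_pairs_def add_in_Z_inverse)
  qed
qed

text \<open>\<open>E\<close> is injective and respects sums and products, so only surjectivity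
  depends on the assumed description of \<open>EndG A\<close>.\<close>

lemma E_ring_iso:
  assumes "EndG A = (\<lambda>(x, y). E x y) ` diag_pairs"
  shows "(\<lambda>(x, y). E x y) \<in>
    ring_iso ((RDirProd (Z_inverse_ring l1) (Z_inverse_ring l2))\<lparr>carrier := diag_pairs\<rparr>) (EndG_ring A)"
proof (rule ring_iso_memI)
  show "bij_betw (\<lambda>(x, y). E x y)
     (carrier ((RDirProd (Z_inverse_ring l1) (Z_inverse_ring l2))\<lparr>carrier := diag_pairs\<rparr>))
     (carrier (EndG_ring A))"
    using assms by (auto simp: bij_betw_def inj_on_def eig_matrix_inject EndG_ring_def)
qed (use assms in \<open>auto simp: EndG_ring_def rat_matrix_ring_def eig_matrix_mult eig_matrix_add
    eig_matrix_1\<close>)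

lemma cring_diag_pairs:
  "cring ((RDirProd (Z_inverse_ring l1) (Z_inverse_ring l2))\<lparr>carrier := diag_pairs\<rparr>)"
proof -
  interpret cring "RDirProd (Z_inverse_ring l1) (Z_inverse_ring l2)"
    by (rule cring_RDirProd_Z_inverse)
  show ?thesis
    using subcringI'[OF subring_diag_pairs] subcring_iff subringE(1)[OF subring_diag_pairs] by blast
qed

text \<open>The upper right entry is -u times (x - y) / v, which the congruence condition places in
  the ring; commutation holds because \<open>A\<close> has the same eigenvectors.\<close>

lemma E_mem_centralizer:
  assumes "(x, y) \<in> diag_pairs"
  shows "E x y \<in> centralizer_over (Z_inverse (l1 * l2)) (rat_matrix A)"
proof -
  have x: "x \<in> Z_inverse (l1 * l2)"
    using assms l1 l2 by (intro Z_inverse_mult_mono) (auto simp: diag_pairs_def)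
  have y: "y \<in> Z_inverse (l1 * l2)"
    using assms l1 l2 Z_inverse_mult_mono[of l2 l1] by (simp add: diag_pairs_def mult.commute)
  have "of_int (- u) * ((x - y) / of_int v) \<in> Z_inverse (l1 * l2)"
    using assms by (intro mult_in_Z_inverse of_int_in_Z_inverse) (simp add: diag_pairs_def)
  also have "of_int (- u) * ((x - y) / of_int v) = of_int u * (y - x) / of_int v"
    using v0 by (simp add: field_simps)
  finally show ?thesis
    using x y by (simp add: centralizer_over_def A_eq eig_matrix_mult forall_2 zero_in_Z_inverse
        mult.commute)
qed

end

theorem theorem3p6:
  fixes l1 l2 u v :: int and A :: "int^2^2" and M :: "rat^2^2"
  assumes "gcd u v = 1"
    and "v \<noteq> 0"
    and "v dvd l1 - l2"
    and "M = vector [vector [1, of_int u], vector [0, of_int v]]"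
    and "rat_matrix A = M ** diag2 (of_int l1) (of_int l2) ** matrix_inv M"
    and "det A \<noteq> 0"
    and "primes_det' A \<noteq> {}"
    and "\<not> rad l1 dvd rad l2"
    and "\<not> rad l2 dvd rad l1"
  shows "(\<forall>T. T \<in> EndG A \<longleftrightarrow>
            (\<exists>x1 x2. T = M ** diag2 x1 x2 ** matrix_inv M
               \<and> x1 \<in> Z_inverse l1 \<and> x2 \<in> Z_inverse l2
               \<and> (x1 - x2) / of_int v \<in> Z_inverse (det A)))
       \<and> cring (EndG_ring A)
       \<and> (\<exists>S. subring S (RDirProd (Z_inverse_ring l1) (Z_inverse_ring l2))
            \<and> EndG_ring A \<simeq> (RDirProd (Z_inverse_ring l1) (Z_inverse_ring l2))\<lparr>carrier := S\<rparr>)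
       \<and> EndG A \<subseteq> centralizer_over (Z_inverse (det A)) (rat_matrix A)"
proof -
  have M_conj: "M ** diag2 x y ** matrix_inv M = eig_matrix (of_int u) (of_int v) x y" for x y
    using assms(2,4) by (intro conj_diag2_eq_eig_matrix) auto
  have A_eq: "rat_matrix A = eig_matrix (of_int u) (of_int v) (of_int l1) (of_int l2)"
    using assms(5) by (simp add: M_conj)
  have det_A: "det A = l1 * l2"
    using A_eq by (rule det_eq_if_rat_matrix_eq_eig_matrix)
  then have l: "l1 \<noteq> 0" "l2 \<noteq> 0" using assms(6) by auto
  interpret split_matrix l1 l2 u v A
    using assms(1-3) l A_eq by unfold_locales
  let ?P = "RDirProd (Z_inverse_ring l1) (Z_inverse_ring l2)"
  \<comment> \<open>The radical hypotheses supply one separating prime for each eigenline.\<close>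
  obtain p where p: "Factorial_Ring.prime p" "p dvd l1" "\<not> p dvd l2"
    using prime_not_dvd_of_rad_not_dvd l assms(8) by blast
  obtain q where q: "Factorial_Ring.prime q" "q dvd l2" "\<not> q dvd l1"
    using prime_not_dvd_of_rad_not_dvd l assms(9) by blast
  have E_iff: "E x y \<in> EndG A \<longleftrightarrow> (x, y) \<in> diag_pairs" for x y
    unfolding E_mem_EndG_iff integral_congruence_iff diag_pairs_def by simp
  have EndG_eq: "EndG A = (\<lambda>(x, y). E x y) ` diag_pairs"
  proof (intro equalityI subsetI)
    fix T :: "rat^2^2"
    assume T: "T \<in> EndG A"
    then have "(T $ 1 $ 1, T $ 2 $ 2) \<in> diag_pairs"
      using EndG_eq_E[OF T p q] E_iff by metis
    with EndG_eq_E[OF T p q] show "T \<in> (\<lambda>(x, y). E x y) ` diag_pairs"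
      by (metis (no_types, lifting) case_prod_conv image_eqI)
  qed (auto simp: E_iff)
  note iso = E_ring_iso[OF EndG_eq]
  have "\<forall>T. T \<in> EndG A \<longleftrightarrow>
            (\<exists>x1 x2. T = M ** diag2 x1 x2 ** matrix_inv M
               \<and> x1 \<in> Z_inverse l1 \<and> x2 \<in> Z_inverse l2
               \<and> (x1 - x2) / of_int v \<in> Z_inverse (det A))"
    unfolding M_conj det_A EndG_eq by (auto simp: diag_pairs_def)
  moreover have "cring (EndG_ring A)"
    \<comment> \<open>Transport along the isomorphism yields a ring whose zero is
      \<open>E 0 0\<close>, identified with the zero matrix by \<open>eig_matrix_0\<close>.\<close>
    using cring.ring_iso_imp_img_cring[OF cring_diag_pairs iso]
    by (simp add: eig_matrix_0 EndG_ring_def rat_matrix_ring_def)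
  moreover have "EndG_ring A \<simeq> ?P\<lparr>carrier := diag_pairs\<rparr>"
    using ring_iso_sym[OF cring.axioms(1)[OF cring_diag_pairs]] iso
    unfolding is_ring_iso_def by blast
  moreover have "EndG A \<subseteq> centralizer_over (Z_inverse (det A)) (rat_matrix A)"
    unfolding det_A EndG_eq using E_mem_centralizer by auto
  ultimately show ?thesis using subring_diag_pairs by blast
qed

end
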